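(* Let $p$ be a probability distribution with $n$ states and let $S=\{p' : p\preceq p'\}$ be the set of all probability distributions $p'$ with $n$ states that majorize $p$. Let $\mathcal{G}_S$ be the output of the greedy coupling algorithm on $S$ and let $\mathrm{OPT}_S$ be a minimum entropy coupling of $S$. Then $$H(\mathcal{G}_S)=H(\mathrm{OPT}_S).$$
   Context: $H$ denotes Shannon entropy with logarithms in base $2$. The states of every distribution $q$ are indexed in non-increasing order, $q(1)\ge q(2)\ge\cdots$. Majorization: $p\preceq q$ ($p$ is majorized by $q$) if $\sum_{j=1}^i p(j)\le\sum_{j=1}^i q(j)$ for all $i$. Coupling: a discrete (finite or countably infinite) distribution $C$ couples a (possibly infinite) set $S$ of distributions with $n$ states if for every $q\in S$ there is a map $f_q$ from the states of $C$ to $\{1,\dots,n\}$ such that $\sum_{k:\,f_q(k)=\ell}C(k)=q(\ell)$ for every $\ell\in\{1,\dots,n\}$. $H(\mathrm{OPT}_S)$ is the minimum of $H(C)$ over all distributions $C$ that couple $S$. Greedy coupling algorithm: set $q^1=q$ for every $q\in S$. At step $t=1,2,\dots$, as long as the remaining mass (the sum of the entries of $q^t$, which is the same for all $q\in S$) is positive, for each $q\in S$ choose an index $k_q$ maximizing $q^t(k)$ over $k\in\{1,\dots,n\}$, set $\mathcal{G}_S(t)=\min_{q\in S}q^t(k_q)$ (read as an infimum over $S$), and let $q^{t+1}$ be obtained from $q^t$ by subtracting $\mathcal{G}_S(t)$ from its entry at index $k_q$ (entries are not re-indexed). The output weights $\mathcal{G}_S(1),\mathcal{G}_S(2),\dots$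 (possibly infinitely many) form a probability distribution, denoted $\mathcal{G}_S$ (with $\mathcal{G}_S(t)=0$ after termination). *)

theory Defs
  imports "HOL-Probability.Probability"
begin

text \<open>
  States are numbered from 0, and so are the steps of the greedy algorithm. A distribution
  with \<open>n\<close> states is a \<^typ>\<open>nat pmf\<close> supported in \<open>{..<n}\<close> (some of the states may
  have weight 0), its states being indexed in non-increasing order of weight.
\<close>

definition sorted_distribution :: "nat \<Rightarrow> nat pmf \<Rightarrow> bool" where
  "sorted_distribution n q \<longleftrightarrow> set_pmf q \<subseteq> {..<n} \<and> antimono (pmf q)"

text \<open>Only meaningful for distributions whose weights are in non-increasing order.\<close>

definition majorized_by :: "nat pmf \<Rightarrow> nat pmf \<Rightarrow> bool"  (infix "\<preceq>" 50) where
  "p \<preceq> q \<longleftrightarrow> (\<forall>i. (\<Sum>j<i. pmf p j) \<le> (\<Sum>j<i. pmf q j))"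

definition majorizing :: "nat \<Rightarrow> nat pmf \<Rightarrow> nat pmf set" where
  "majorizing n p = {p'. sorted_distribution n p' \<and> p \<preceq> p'}"

text \<open>
  The entropy of a countable distribution may be infinite, hence the values in
  \<^typ>\<open>ennreal\<close>. The coercion does not truncate when all weights are in \<open>[0, 1]\<close>, and a
  weight 0 contributes 0.
\<close>

definition shannon_entropy :: "(nat \<Rightarrow> real) \<Rightarrow> ennreal" where
  "shannon_entropy w = (\<Sum>k. ennreal (- (w k * log 2 (w k))))"

text \<open>
  A finite or countably infinite distribution is represented, up to the names of its states, by
  a \<^typ>\<open>nat pmf\<close>; the order of its states is immaterial here. The equation
  \<open>map_pmf f C = q\<close> says that for every state \<open>l\<close> the weights \<open>pmf C k\<close> with \<open>f k = l\<close>
  sum to \<open>pmf q l\<close>.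
\<close>

definition couples :: "nat \<Rightarrow> nat pmf \<Rightarrow> nat pmf set \<Rightarrow> bool" where
  "couples n C S \<longleftrightarrow> (\<forall>q\<in>S. \<exists>f. (\<forall>k. f k < n) \<and> map_pmf f C = q)"

definition min_entropy_coupling :: "nat \<Rightarrow> nat pmf set \<Rightarrow> nat pmf \<Rightarrow> bool" where
  "min_entropy_coupling n S C \<longleftrightarrow> couples n C S \<and>
     (\<forall>C'. couples n C' S \<longrightarrow> shannon_entropy (pmf C) \<le> shannon_entropy (pmf C'))"

text \<open>
  In the greedy algorithm, \<open>r q\<close> is the vector of remaining weights of \<open>q\<close> at the current
  step and \<open>c q\<close> the index chosen for \<open>q\<close>. The remaining mass is the same for all
  \<open>q \<in> S\<close>, so it does not matter for which of them it is tested.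
\<close>

definition mass_left :: "nat \<Rightarrow> nat pmf set \<Rightarrow> (nat pmf \<Rightarrow> nat \<Rightarrow> real) \<Rightarrow> bool" where
  "mass_left n S r \<longleftrightarrow> (\<exists>q\<in>S. (\<Sum>j<n. r q j) > 0)"

definition step_weight ::
    "nat \<Rightarrow> nat pmf set \<Rightarrow> (nat pmf \<Rightarrow> nat \<Rightarrow> real) \<Rightarrow> (nat pmf \<Rightarrow> nat) \<Rightarrow> real" where
  "step_weight n S r c = (if mass_left n S r then INF q\<in>S. r q (c q) else 0)"

text \<open>
  Ties may be broken arbitrarily: \<open>k q t\<close> is the index chosen for \<open>q\<close> at step \<open>t\<close>, and
  \<open>greedy_choice\<close> below states that it is a legal choice as long as the algorithm runs.
\<close>

primrec residual ::
    "nat \<Rightarrow> nat pmf set \<Rightarrow> (nat pmf \<Rightarrow> nat \<Rightarrow> nat) \<Rightarrow> nat \<Rightarrow> nat pmf \<Rightarrow> nat \<Rightarrow> real" where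
  "residual n S k 0 = (\<lambda>q. pmf q)"
| "residual n S k (Suc t) = (\<lambda>q. (residual n S k t q)
     (k q t := residual n S k t q (k q t) - step_weight n S (residual n S k t) (\<lambda>q. k q t)))"

definition greedy_choice :: "nat \<Rightarrow> nat pmf set \<Rightarrow> (nat pmf \<Rightarrow> nat \<Rightarrow> nat) \<Rightarrow> bool" where
  "greedy_choice n S k \<longleftrightarrow> (\<forall>t. mass_left n S (residual n S k t) \<longrightarrow>
     (\<forall>q\<in>S. is_arg_max (residual n S k t q) (\<lambda>j. j < n) (k q t)))"

definition greedy :: "nat \<Rightarrow> nat pmf set \<Rightarrow> (nat pmf \<Rightarrow> nat \<Rightarrow> nat) \<Rightarrow> nat \<Rightarrow> real" where
  "greedy n S k t = step_weight n S (residual n S k t) (\<lambda>q. k q t)"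

lemma greedy_choice_exists:
  assumes "n > 0"
  shows "\<exists>k. greedy_choice n S k"
proof -
  have "\<exists>i. is_arg_max v (\<lambda>j. j < n) i" for v :: "nat \<Rightarrow> real"
  proof -
    have "finite (v ` {..<n})" "v ` {..<n} \<noteq> {}"
      using assms by auto
    from Max_in[OF this] obtain i where i: "i < n" "v i = Max (v ` {..<n})"
      by auto
    have "v j \<le> v i" if "j < n" for j
      using that unfolding i(2) by (intro Max_ge) auto
    with i(1) show ?thesis
      by (auto simp: is_arg_max_linorder)
  qed
  then obtain m where m: "is_arg_max v (\<lambda>j. j < n) (m v)" for v :: "nat \<Rightarrow> real"
    by metis
  define step where "step r = (\<lambda>q. (r q)
    (m (r q) := r q (m (r q)) - step_weight n S r (\<lambda>q. m (r q))))" for r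
  define R where "R t = (step ^^ t) (\<lambda>q. pmf q)" for t
  define k where "k q t = m (R t q)" for q t
  have "residual n S k t = R t" for t
    by (induction t) (simp_all add: R_def[of 0] R_def[of "Suc _"] step_def k_def
      flip: R_def)
  then have "greedy_choice n S k"
    using m by (simp add: greedy_choice_def k_def)
  then show ?thesis by blast
qed

end

theory Submission
  imports Defs
begin

text \<open>
  Let \<open>P i\<close> be the sum of the \<open>i\<close> largest weights of \<open>p\<close>. After total weight
  \<open>x\<close> has been removed, the first \<open>i\<close> entries of any \<open>q \<in> S\<close> still have mass at least
  \<open>P i - x\<close>, so the next greedy weight is at least \<open>max\<^sub>i (P i - x) / i\<close>. Conversely, let
  \<open>B\<close> be a set of states of a coupling \<open>C\<close> with total weight \<open>x\<close>, let \<open>a\<close> be a further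
  state that is not heavier than those in \<open>B\<close>, and let \<open>m = max\<^sub>i (P i - x) / i\<close>. The
  distribution \<open>(x + m, m, m, \<dots>)\<close>, cut off at total mass 1, majorizes \<open>p\<close>. If \<open>a\<close>
  were heavier than \<open>m\<close>, then \<open>a\<close> and all of \<open>B\<close> would have to be mapped to its first
  state, which has no room for them. As \<open>x + max\<^sub>i (P i - x) / i\<close> is monotone in \<open>x\<close>, it
  follows by induction that the greedy coupling majorizes every coupling, and entropy is
  Schur concave.
\<close>

section \<open>Schur concavity of the entropy\<close>

lemma infinite_set_pmf_argmax:
  fixes C :: "nat pmf"
  assumes "infinite X"
  obtains m where "m \<in> X" "\<And>y. y \<in> X \<Longrightarrow> pmf C y \<le> pmf C m"
proof (cases "\<exists>b\<in>X. pmf C b > 0")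
  case True
  then obtain b where b: "b \<in> X" "pmf C b > 0" by blast
  define Y where "Y = {y \<in> X. pmf C b \<le> pmf C y}"
  \<comment> \<open>As the weights tend to 0, only finitely many states weigh at least
    \<open>pmf C b\<close>, and a maximum over these is a maximum over \<open>X\<close>.\<close>
  have "pmf C \<longlonglongrightarrow> 0"
    by (rule summable_LIMSEQ_zero)
      (use pmf_abs_summable[of C UNIV] in \<open>simp add: abs_summable_on_nat_iff'\<close>)
  then have "eventually (\<lambda>y. pmf C y < pmf C b) sequentially"
    using b(2) by (rule order_tendstoD)
  then obtain N where "\<And>y. y \<ge> N \<Longrightarrow> pmf C y < pmf C b"
    by (auto simp: eventually_sequentially)
  then have "Y \<subseteq> {..<N}"
    by (fastforce simp: Y_def not_less[symmetric])
  then have fin: "finite (pmf C ` Y)" "pmf C ` Y \<noteq> {}"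
    using b(1) finite_subset by (auto simp: Y_def)
  from Max_in[OF this] obtain m where m: "m \<in> Y" "pmf C m = Max (pmf C ` Y)"
    by auto
  have "pmf C y \<le> pmf C m" if "y \<in> X" for y
  proof (cases "y \<in> Y")
    case True
    then show ?thesis using fin m(2) by simp
  next
    case False
    then show ?thesis using that m(1) by (auto simp: Y_def)
  qed
  then show thesis using m(1) that by (auto simp: Y_def)
next
  case False
  obtain m where "m \<in> X" using assms by (metis finite.emptyI ex_in_conv)
  then show thesis using False that by (metis not_le pmf_nonneg order_trans)
qed

text \<open>Repeatedly picks a heaviest state not yet listed. A finite list suffices because
  entropies are compared through partial sums, and it avoids a full enumeration, which could miss
  states of weight 0.\<close>

lemma pmf_decreasing_enumeration:
  fixes C :: "nat pmf" and N :: nat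
  shows "\<exists>\<sigma>. inj_on \<sigma> {..<N} \<and> (\<forall>i j. i \<le> j \<longrightarrow> j < N \<longrightarrow> pmf C (\<sigma> j) \<le> pmf C (\<sigma> i)) \<and>
    (\<forall>y i. y \<notin> \<sigma> ` {..<N} \<longrightarrow> i < N \<longrightarrow> pmf C y \<le> pmf C (\<sigma> i))"
proof (induction N)
  case 0
  then show ?case by simp
next
  case (Suc N)
  then obtain \<sigma> where \<sigma>: "inj_on \<sigma> {..<N}"
    "\<And>i j. i \<le> j \<Longrightarrow> j < N \<Longrightarrow> pmf C (\<sigma> j) \<le> pmf C (\<sigma> i)"
    "\<And>y i. y \<notin> \<sigma> ` {..<N} \<Longrightarrow> i < N \<Longrightarrow> pmf C y \<le> pmf C (\<sigma> i)"
    by blast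
  have "infinite (- \<sigma> ` {..<N})" by simp
  then obtain m where m: "m \<in> - \<sigma> ` {..<N}"
    "\<And>y. y \<in> - \<sigma> ` {..<N} \<Longrightarrow> pmf C y \<le> pmf C m"
    using infinite_set_pmf_argmax by metis
  define \<tau> where "\<tau> = \<sigma>(N := m)"
  have im: "\<tau> ` {..<Suc N} = insert m (\<sigma> ` {..<N})"
    by (auto simp: \<tau>_def lessThan_Suc)
  have "inj_on \<tau> {..<Suc N}"
    using \<sigma>(1) m(1) by (auto simp: \<tau>_def lessThan_Suc inj_on_def)
  moreover have "pmf C (\<tau> j) \<le> pmf C (\<tau> i)" if "i \<le> j" "j < Suc N" for i j
    using that \<sigma>(2,3) m(1) by (auto simp: \<tau>_def less_Suc_eq)
  moreover have "pmf C y \<le> pmf C (\<tau> i)" if "y \<notin> \<tau> ` {..<Suc N}" "i < Suc N" for y i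
    using that \<sigma>(3) m(2) unfolding im by (auto simp: \<tau>_def less_Suc_eq)
  ultimately show ?case by blast
qed

text \<open>By concavity: the right-hand side is the tangent of \<open>- (g * log 2 g)\<close> at
  \<open>g = c\<close>. It reduces to \<open>ln z \<le> z - 1\<close> at
  \<open>z = c / g\<close>.\<close>

lemma neg_xlogx_le_tangent:
  fixes g c :: real
  assumes "g \<ge> 0" "c > 0"
  shows "- (g * log 2 g) \<le> - (g * log 2 c) + (c - g) / ln 2"
proof (cases "g = 0")
  case False
  then have g: "g > 0" using assms by simp
  have "g * ln (c / g) \<le> g * (c / g - 1)"
    using g assms(2) by (intro mult_left_mono ln_le_minus_one) auto
  also have "\<dots> = c - g"
    using g by (simp add: field_simps)
  finally have "g * ln c - g * ln g \<le> c - g"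
    using g assms(2) by (simp add: ln_div algebra_simps)
  then have "(g * ln c - g * ln g) / ln 2 \<le> (c - g) / ln 2"
    by (intro divide_right_mono) auto
  then show ?thesis
    by (simp add: log_def diff_divide_distrib)
qed (use assms in simp)

text \<open>Abel summation as an induction: each step replaces the factor of a nonnegative prefix
  sum by a larger one. The total over \<open>Suc N\<close> terms may be negative, since its factor
  \<open>L N\<close> is never enlarged.\<close>

lemma sum_mult_mono_le:
  fixes L d :: "nat \<Rightarrow> real"
  assumes "\<And>i j. i \<le> j \<Longrightarrow> j \<le> N \<Longrightarrow> L i \<le> L j"
    and "\<And>m. m \<le> N \<Longrightarrow> 0 \<le> (\<Sum>i<m. d i)"
  shows "(\<Sum>i<Suc N. L i * d i) \<le> L N * (\<Sum>i<Suc N. d i)"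
  using assms
proof (induction N)
  case (Suc N)
  have "(\<Sum>i<Suc N. L i * d i) \<le> L N * (\<Sum>i<Suc N. d i)"
    using Suc by simp
  also have "\<dots> \<le> L (Suc N) * (\<Sum>i<Suc N. d i)"
    using Suc.prems(1)[of N "Suc N"] Suc.prems(2)[of "Suc N"] by (intro mult_right_mono) auto
  finally show ?case
    by (subst sum.lessThan_Suc, subst (2) sum.lessThan_Suc) (simp add: distrib_left)
qed simp

lemma suminf_split_finite:
  fixes f :: "nat \<Rightarrow> real"
  assumes "summable f" "finite A"
  shows "summable (\<lambda>k. if k \<in> A then 0 else f k)"
    and "suminf f = sum f A + (\<Sum>k. if k \<in> A then 0 else f k)"
proof -
  have A: "(\<lambda>k. if k \<in> A then f k else 0) sums sum f A"
    using assms(2) by (rule sums_If_finite_set)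
  have "(\<lambda>k. f k - (if k \<in> A then f k else 0)) sums (suminf f - sum f A)"
    using assms(1) A by (intro sums_diff summable_sums)
  also have "(\<lambda>k. f k - (if k \<in> A then f k else 0)) = (\<lambda>k. if k \<in> A then 0 else f k)"
    by auto
  finally show "summable (\<lambda>k. if k \<in> A then 0 else f k)"
    and "suminf f = sum f A + (\<Sum>k. if k \<in> A then 0 else f k)"
    by (auto simp: sums_iff)
qed

lemma measure_pmf_nat_sums:
  fixes C :: "nat pmf"
  shows "(\<lambda>t. if t \<in> A then pmf C t else 0) sums measure C A"
  unfolding measure_pmf_conv_infsetsum by (intro sums_infsetsum_nat pmf_abs_summable)

lemma pmf_nat_sums_1:
  fixes C :: "nat pmf"
  shows "pmf C sums 1"
  using measure_pmf_nat_sums[of UNIV C] by simp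

lemma entropy_summand_nonneg:
  fixes x :: real
  assumes "0 \<le> x" "x \<le> 1"
  shows "0 \<le> - (x * log 2 x)"
  using assms by (cases "x = 0") (auto simp: mult_le_0_iff)

text \<open>
  Each \<open>- g log g\<close> is bounded by the tangent at the corresponding weight \<open>c\<close> of \<open>C\<close>, the
  weights of \<open>C\<close> being taken in decreasing order. Abel summation leaves the error
  \<open>- log c\<^sub>N\<close> times the tail mass of \<open>C\<close>, which is at most the tail of the entropy of \<open>C\<close>,
  so every partial sum is bounded by the full entropy of \<open>C\<close> and no limit is needed.
\<close>

lemma shannon_entropy_le_of_majorized:
  fixes C :: "nat pmf" and g :: "nat \<Rightarrow> real"
  assumes nonneg: "\<And>t. 0 \<le> g t"
    and le1: "\<And>N. (\<Sum>t<N. g t) \<le> 1"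
    and maj: "\<And>A. finite A \<Longrightarrow> (\<Sum>a\<in>A. pmf C a) \<le> (\<Sum>t<card A. g t)"
  shows "shannon_entropy g \<le> shannon_entropy (pmf C)"
proof (cases "shannon_entropy (pmf C) = \<infinity>")
  case False
  define h where "h k = - (pmf C k * log 2 (pmf C k))" for k
  have h_nonneg: "0 \<le> h k" for k
    unfolding h_def by (rule entropy_summand_nonneg) (auto simp: pmf_le_1)
  have h_summable: "summable h"
    using False h_nonneg by (intro summable_suminf_not_top)
      (auto simp: shannon_entropy_def h_def top_ennreal_def)
  have ent: "shannon_entropy (pmf C) = ennreal (suminf h)"
    unfolding shannon_entropy_def h_def[symmetric]
    using h_nonneg h_summable by (rule suminf_ennreal2)
  have g_le1: "g t \<le> 1" for t
    using le1[of "Suc t"] sum_nonneg[of "{..<t}" g] nonneg by simp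
  have partial: "(\<Sum>t<N. - (g t * log 2 (g t))) \<le> suminf h" for N
  proof (induction N)
    case 0
    then show ?case using h_nonneg h_summable by (simp add: suminf_nonneg)
  next
    case (Suc N)
    obtain \<sigma> where \<sigma>: "inj_on \<sigma> {..<Suc N}"
      "\<And>i j. i \<le> j \<Longrightarrow> j < Suc N \<Longrightarrow> pmf C (\<sigma> j) \<le> pmf C (\<sigma> i)"
      "\<And>y i. y \<notin> \<sigma> ` {..<Suc N} \<Longrightarrow> i < Suc N \<Longrightarrow> pmf C y \<le> pmf C (\<sigma> i)"
      using pmf_decreasing_enumeration[of "Suc N" C] by blast
    define c where "c i = pmf C (\<sigma> i)" for i
    have D: "(\<Sum>i<m. c i) \<le> (\<Sum>i<m. g i)" if "m \<le> Suc N" for m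
    proof -
      have inj: "inj_on \<sigma> {..<m}"
        using \<sigma>(1) by (rule inj_on_subset) (use that in auto)
      then have "(\<Sum>a\<in>\<sigma> ` {..<m}. pmf C a) = (\<Sum>i<m. c i)"
        by (simp add: sum.reindex c_def)
      with maj[of "\<sigma> ` {..<m}"] inj show ?thesis by (simp add: card_image)
    qed
    define A where "A = \<sigma> ` {..<Suc N}"
    have fin: "finite A" by (simp add: A_def)
    have sumA: "sum F A = (\<Sum>i<Suc N. F (\<sigma> i))" for F :: "nat \<Rightarrow> real"
      unfolding A_def using \<sigma>(1) by (simp add: sum.reindex del: sum.lessThan_Suc)
    have C_split: "summable (\<lambda>k. if k \<in> A then 0 else pmf C k)"
      "1 = (\<Sum>i<Suc N. c i) + (\<Sum>k. if k \<in> A then 0 else pmf C k)"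
      using suminf_split_finite[OF sums_summable[OF pmf_nat_sums_1] fin, of C]
        sums_unique[OF pmf_nat_sums_1, of C] by (simp_all add: sumA c_def del: sum.lessThan_Suc)
    have h_split: "summable (\<lambda>k. if k \<in> A then 0 else h k)"
      "suminf h = (\<Sum>i<Suc N. h (\<sigma> i)) + (\<Sum>k. if k \<in> A then 0 else h k)"
      using suminf_split_finite[OF h_summable fin] by (simp_all add: sumA del: sum.lessThan_Suc)
    show ?case
    \<comment> \<open>If \<open>c N = 0\<close>, the first \<open>N\<close> listed states carry all
      the mass, so \<open>g N = 0\<close> and the induction hypothesis is enough. Otherwise all
      listed weights are positive and the tangent bound applies directly.\<close>
    proof (cases "c N = 0")
      case True
      have "pmf C k = 0" if "k \<notin> A" for k
        using \<sigma>(3)[of k N] that True pmf_nonneg[of C k] by (simp add: A_def c_def)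
      then have "(\<lambda>k. if k \<in> A then 0 else pmf C k) = (\<lambda>_. 0)" by auto
      then have "1 = (\<Sum>i<N. c i)" using C_split(2) True by simp
      then have "g N = 0"
        using D[of N] le1[of "Suc N"] nonneg[of N] by simp
      then show ?thesis using Suc by simp
    next
      case False
      then have cN: "c N > 0" by (simp add: c_def less_le)
      have c_mono: "c N \<le> c i" if "i < Suc N" for i
        using \<sigma>(2)[of i N] that by (simp add: c_def)
      define L where "L i = - log 2 (c i)" for i
      have L_mono: "L i \<le> L j" if "i \<le> j" "j \<le> N" for i j
      proof -
        have "0 < c j" using c_mono[of j] cN that by simp
        moreover have "c j \<le> c i" using \<sigma>(2)[of i j] that by (simp add: c_def)
        ultimately show ?thesis by (simp add: L_def)
      qed
      have L_nonneg: "0 \<le> L N"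
        using cN by (simp add: L_def c_def pmf_le_1)
      \<comment> \<open>States outside \<open>A\<close> weigh at most \<open>c N\<close>, so their
        negative logarithm is at least \<open>L N\<close>.\<close>
      have tail: "L N * (\<Sum>k. if k \<in> A then 0 else pmf C k) \<le> (\<Sum>k. if k \<in> A then 0 else h k)"
      proof -
        have "L N * (if k \<in> A then 0 else pmf C k) \<le> (if k \<in> A then 0 else h k)" for k
        proof (cases "k \<in> A \<or> pmf C k = 0")
          case False
          then have k: "0 < pmf C k" "pmf C k \<le> c N"
            using \<sigma>(3)[of k N] by (auto simp: c_def A_def less_le)
          then have "L N \<le> - log 2 (pmf C k)" by (simp add: L_def)
          then have "L N * pmf C k \<le> - log 2 (pmf C k) * pmf C k"
            by (intro mult_right_mono) auto
          then show ?thesis using False by (simp add: h_def mult.commute)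
        qed (auto simp: h_def)
        then show ?thesis
          unfolding suminf_mult[OF C_split(1), symmetric]
          by (intro suminf_le summable_mult C_split(1) h_split(1))
      qed
      have "(\<Sum>i<Suc N. - (g i * log 2 (g i)))
          \<le> (\<Sum>i<Suc N. - (g i * log 2 (c i)) + (c i - g i) / ln 2)"
        using nonneg cN c_mono
        by (intro sum_mono neg_xlogx_le_tangent) (auto intro: less_le_trans simp del: sum.lessThan_Suc)
      also have "\<dots> = (\<Sum>i<Suc N. h (\<sigma> i)) + (\<Sum>i<Suc N. L i * (g i - c i))
          + ((\<Sum>i<Suc N. c i) - (\<Sum>i<Suc N. g i)) / ln 2"
        unfolding sum.distrib[symmetric] sum_subtractf[symmetric] sum_divide_distrib
        by (intro sum.cong) (auto simp: h_def L_def c_def algebra_simps)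
      also have "\<dots> \<le> (\<Sum>i<Suc N. h (\<sigma> i)) + (\<Sum>i<Suc N. L i * (g i - c i))"
        using D[of "Suc N"] by (simp add: divide_le_0_iff del: sum.lessThan_Suc)
      also have "\<dots> \<le> (\<Sum>i<Suc N. h (\<sigma> i)) + L N * (\<Sum>i<Suc N. g i - c i)"
        using L_mono D by (intro add_left_mono sum_mult_mono_le) (auto simp: sum_subtractf)
      \<comment> \<open>The \<open>g i\<close> sum to at most 1, so their excess over the
        \<open>c i\<close> is at most the mass of \<open>C\<close> outside \<open>A\<close>.\<close>
      also have "\<dots> \<le> (\<Sum>i<Suc N. h (\<sigma> i)) + L N * (\<Sum>k. if k \<in> A then 0 else pmf C k)"
        using C_split(2) le1[of "Suc N"] L_nonneg
        by (intro add_left_mono mult_left_mono) (auto simp: sum_subtractf)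
      also have "\<dots> \<le> suminf h"
        using tail h_split(2) by simp
      finally show ?thesis .
    qed
  qed
  have "(\<Sum>t. ennreal (- (g t * log 2 (g t)))) \<le> ennreal (suminf h)"
  proof (rule suminf_le_const)
    fix N
    have "0 \<le> - (g t * log 2 (g t))" for t
      by (rule entropy_summand_nonneg) (auto simp: nonneg g_le1)
    then show "(\<Sum>t<N. ennreal (- (g t * log 2 (g t)))) \<le> ennreal (suminf h)"
      using partial[of N] by (subst sum_ennreal) (auto intro: ennreal_leI)
  qed simp
  then show ?thesis unfolding ent by (simp add: shannon_entropy_def)
qed simp

section \<open>The greedy coupling majorizes every coupling\<close>

lemma pmf_of_sums:
  fixes w :: "nat \<Rightarrow> real"
  assumes "\<And>i. 0 \<le> w i" "w sums 1"
  obtains W where "pmf W = w"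
proof
  have "(\<integral>\<^sup>+ x. ennreal (w x) \<partial>count_space UNIV) = ennreal 1"
    using assms by (simp add: nn_integral_count_space_nat suminf_ennreal2 sums_iff)
  then show "pmf (embed_pmf w) = w"
    using assms(1) by (intro ext pmf_embed_pmf) auto
qed

lemma sum_pmf_le_1: "(\<Sum>a\<in>A. pmf C a) \<le> 1"
  by (cases "finite A") (auto simp flip: measure_measure_pmf_finite simp: measure_pmf.prob_le_1)

lemma sorted_distribution_sum:
  assumes "sorted_distribution n q"
  shows "(\<Sum>j<n. pmf q j) = 1"
  using assms by (intro sum_pmf_eq_1) (auto simp: sorted_distribution_def)

lemma sorted_distribution_pos:
  assumes "sorted_distribution n q"
  shows "0 < n"
  using sorted_distribution_sum[OF assms] by (cases n) auto

lemma self_in_majorizing: "sorted_distribution n p \<Longrightarrow> p \<in> majorizing n p"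
  by (simp add: majorizing_def majorized_by_def)

section \<open>Upper bound for the weights of a coupling\<close>

lemma majorizing_test_distribution:
  fixes x m :: real
  assumes p: "sorted_distribution n p"
    and x: "0 \<le> x" and m: "0 \<le> m"
    and le: "\<And>i. 1 \<le> i \<Longrightarrow> i \<le> n \<Longrightarrow> (\<Sum>j<i. pmf p j) \<le> x + real i * m"
  obtains q where "q \<in> majorizing n p" "pmf q 0 \<le> x + m" "\<And>l. 0 < l \<Longrightarrow> pmf q l \<le> m"
proof -
  note n = sorted_distribution_pos[OF p]
  \<comment> \<open>\<open>Q\<close> prescribes the prefix sums. The separate value at 0 puts the
    extra mass \<open>x\<close> into the first state; the cap 1 is reached by index
    \<open>n\<close>, by the hypothesis at \<open>i = n\<close>.\<close>
  define Q where "Q i = (if i = 0 then 0 else min 1 (x + real i * m))" for i :: nat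
  define w where "w i = Q (Suc i) - Q i" for i
  have sum_w: "(\<Sum>j<i. w j) = Q i" for i
    unfolding w_def by (subst sum_lessThan_telescope) (simp add: Q_def)
  have Q1: "Q i = 1" if "n \<le> i" for i
  proof -
    have "1 \<le> x + real n * m"
      using le[of n] n sorted_distribution_sum[OF p] by simp
    also have "\<dots> \<le> x + real i * m"
      using that m by (intro add_left_mono mult_right_mono) auto
    finally show ?thesis using n that by (auto simp: Q_def)
  qed
  have w0: "w i = 0" if "n \<le> i" for i
    using that Q1 by (simp add: w_def)
  have w_nonneg: "0 \<le> w i" for i
    using x m by (auto simp: w_def Q_def min_def algebra_simps)
  have "w sums (\<Sum>j<n. w j)"
    by (rule sums_finite) (auto simp: w0)
  then have "w sums 1" using sum_w Q1 by simp
  with w_nonneg obtain q where q: "pmf q = w" by (rule pmf_of_sums)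
  have "w (Suc i) \<le> w i" for i
    using x m by (auto simp: w_def Q_def min_def algebra_simps)
  then have "antimono w" by (rule decseq_SucI)
  moreover have "set_pmf q \<subseteq> {..<n}"
    using w0 by (auto simp: set_pmf_eq q not_le[symmetric])
  moreover have "p \<preceq> q"
    unfolding majorized_by_def q sum_w
  proof
    fix i
    show "(\<Sum>j<i. pmf p j) \<le> Q i"
      using Q1[of i] le[of i] sum_pmf_le_1[of p "{..<i}"]
      by (cases "i = 0"; cases "n \<le> i") (auto simp: Q_def)
  qed
  ultimately have "q \<in> majorizing n p"
    by (simp add: majorizing_def sorted_distribution_def q)
  moreover have "pmf q 0 \<le> x + m"
    by (simp add: q w_def Q_def)
  moreover have "pmf q l \<le> m" if "0 < l" for l
    using that m by (auto simp: q w_def Q_def min_def algebra_simps)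
  ultimately show thesis by (rule that)
qed

text \<open>The test distribution is taken with the least admissible \<open>m\<close>. Naming an
  index \<open>i\<close> that attains the maximum lets \<open>greedy_ge\<close> be used later at the
  same index.\<close>

lemma coupling_weight_le:
  assumes p: "sorted_distribution n p"
    and C: "couples n C (majorizing n p)"
    and B: "finite B" "a \<notin> B" "\<And>b. b \<in> B \<Longrightarrow> pmf C a \<le> pmf C b"
  obtains i where "1 \<le> i" "i \<le> n" "pmf C a \<le> ((\<Sum>j<i. pmf p j) - (\<Sum>b\<in>B. pmf C b)) / real i"
proof -
  define x where "x = (\<Sum>b\<in>B. pmf C b)"
  define F where "F i = ((\<Sum>j<i. pmf p j) - x) / real i" for i
  note n = sorted_distribution_pos[OF p]
  define m where "m = Max (F ` {1..n})"
  have ne: "finite (F ` {1..n})" "F ` {1..n} \<noteq> {}" using n by auto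
  have Fm: "F i \<le> m" if "1 \<le> i" "i \<le> n" for i
    unfolding m_def using that by (intro Max_ge) auto
  have x: "0 \<le> x" "x \<le> 1"
    by (auto simp: x_def sum_nonneg sum_pmf_le_1)
  \<comment> \<open>The index \<open>n\<close> forces \<open>m\<close> to be nonnegative: the
    weights of \<open>p\<close> sum to 1, and \<open>x\<close> is at most 1.\<close>
  have "0 \<le> F n"
    using x(2) sorted_distribution_sum[OF p] by (simp add: F_def)
  then have m: "0 \<le> m" using Fm[of n] n by simp
  have "(\<Sum>j<i. pmf p j) \<le> x + real i * m" if "1 \<le> i" "i \<le> n" for i
    using Fm[OF that] that by (simp add: F_def field_simps)
  with p x(1) m obtain q where q: "q \<in> majorizing n p" "pmf q 0 \<le> x + m"
    "\<And>l. 0 < l \<Longrightarrow> pmf q l \<le> m"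
    by (rule majorizing_test_distribution) blast+
  from C q(1) obtain f where f: "map_pmf f C = q" by (auto simp: couples_def)
  have sum_le: "(\<Sum>c\<in>A. pmf C c) \<le> pmf q l" if "finite A" "A \<subseteq> f -` {l}" for A l
    using that unfolding f[symmetric] pmf_map
    by (subst measure_measure_pmf_finite[symmetric])
      (auto intro!: measure_pmf.finite_measure_mono)
  have "pmf C a \<le> m"
  proof (rule ccontr)
    assume *: "\<not> pmf C a \<le> m"
    have "f b = 0" if "b \<in> insert a B" for b
    proof (rule ccontr)
      assume "f b \<noteq> 0"
      then have "pmf C b \<le> m"
        using sum_le[of "{b}" "f b"] q(3)[of "f b"] by simp
      then show False using * that B(3)[of b] by auto
    qed
    then have "(\<Sum>c\<in>insert a B. pmf C c) \<le> pmf q 0"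
      using B(1) by (intro sum_le) auto
    then show False using q(2) B * by (simp add: x_def)
  qed
  moreover obtain i where "i \<in> {1..n}" "m = F i"
    using Max_in[OF ne] unfolding m_def by blast
  ultimately show thesis using that by (auto simp: F_def x_def)
qed

section \<open>Invariants of a greedy run and lower bound for its weights\<close>

locale greedy_run =
  fixes n :: nat and p :: "nat pmf" and k :: "nat pmf \<Rightarrow> nat \<Rightarrow> nat"
  assumes p: "sorted_distribution n p"
    and choice: "greedy_choice n (majorizing n p) k"
begin

abbreviation "S \<equiv> majorizing n p"
abbreviation "r \<equiv> residual n S k"
abbreviation "G \<equiv> greedy n S k"

lemma residual_Suc: "r (Suc t) q = (r t q)(k q t := r t q (k q t) - G t)"
  by (simp add: greedy_def)

declare residual.simps(2) [simp del]

lemma k_less: "mass_left n S (r t) \<Longrightarrow> q \<in> S \<Longrightarrow> k q t < n"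
  using choice by (auto simp: greedy_choice_def is_arg_max_def)

lemma residual_le: "mass_left n S (r t) \<Longrightarrow> q \<in> S \<Longrightarrow> j < n \<Longrightarrow> r t q j \<le> r t q (k q t)"
  using choice by (auto simp: greedy_choice_def is_arg_max_linorder)

text \<open>Nonnegative residuals bound the real infimum from below, so that it is a genuine lower
  bound. This is the inductive step of \<open>residual_nonneg\<close>.\<close>

lemma greedy_bounds:
  assumes "\<And>q j. q \<in> S \<Longrightarrow> 0 \<le> r t q j"
  shows "0 \<le> G t" and "q \<in> S \<Longrightarrow> G t \<le> r t q (k q t)"
proof -
  have bdd: "bdd_below ((\<lambda>q. r t q (k q t)) ` S)"
    using assms by (intro bdd_belowI[of _ 0]) auto
  show "0 \<le> G t"
    unfolding greedy_def step_weight_def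
    using assms self_in_majorizing[OF p] by (auto intro!: cINF_greatest)
  show "G t \<le> r t q (k q t)" if "q \<in> S"
    unfolding greedy_def step_weight_def using assms that bdd by (auto intro!: cINF_lower)
qed

lemma residual_nonneg: "q \<in> S \<Longrightarrow> 0 \<le> r t q j"
proof (induction t arbitrary: q j)
  case (Suc t)
  then show ?case using greedy_bounds(2)[of t q] by (simp add: residual_Suc)
qed simp

lemmas greedy_nonneg = greedy_bounds(1)[OF residual_nonneg]

lemma greedy_zero: "\<not> mass_left n S (r t) \<Longrightarrow> G t = 0"
  by (simp add: greedy_def step_weight_def)

lemma residual_eq: "r t q j = pmf q j - (\<Sum>s<t. if k q s = j then G s else 0)"
  by (induction t) (auto simp: residual_Suc)

lemma residual_mass:
  assumes "q \<in> S"
  shows "(\<Sum>j<n. r t q j) = 1 - (\<Sum>s<t. G s)"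
proof -
  have "(\<Sum>j<n. \<Sum>s<t. if k q s = j then G s else 0) = (\<Sum>s<t. \<Sum>j<n. if k q s = j then G s else 0)"
    by (rule sum.swap)
  \<comment> \<open>After termination \<open>k q s\<close> is unconstrained and may lie outside the
    range, but then \<open>G s = 0\<close>.\<close>
  also have "\<dots> = (\<Sum>s<t. G s)"
    using greedy_zero k_less[OF _ assms] by (intro sum.cong) (auto simp: sum.delta')
  moreover have "(\<Sum>j<n. pmf q j) = 1"
    using assms by (simp add: sorted_distribution_sum majorizing_def)
  ultimately show ?thesis
    by (simp add: residual_eq sum_subtractf)
qed

lemma mass_left_iff: "mass_left n S (r t) \<longleftrightarrow> (\<Sum>s<t. G s) < 1"
  using self_in_majorizing[OF p] by (auto simp: mass_left_def residual_mass)

lemma sum_greedy_le_1: "(\<Sum>s<t. G s) \<le> 1"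
  using residual_mass[OF self_in_majorizing[OF p], of t]
    sum_nonneg[of "{..<n}" "r t p"] residual_nonneg[OF self_in_majorizing[OF p]] by simp

text \<open>A largest entry is at least the mean of the first \<open>i\<close> entries, uniformly in
  \<open>q\<close>. After termination the left side is at most 0.\<close>

lemma greedy_ge:
  assumes "1 \<le> i" "i \<le> n"
  shows "((\<Sum>j<i. pmf p j) - (\<Sum>s<t. G s)) / real i \<le> G t"
proof (cases "mass_left n S (r t)")
  case True
  have "((\<Sum>j<i. pmf p j) - (\<Sum>s<t. G s)) / real i \<le> r t q (k q t)" if q: "q \<in> S" for q
  proof -
    have "(\<Sum>j<i. \<Sum>s<t. if k q s = j then G s else 0) = (\<Sum>s<t. \<Sum>j<i. if k q s = j then G s else 0)"
      by (rule sum.swap)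
    also have "\<dots> \<le> (\<Sum>s<t. G s)"
      by (intro sum_mono) (auto simp: sum.delta' greedy_nonneg)
    finally have "(\<Sum>j<i. \<Sum>s<t. if k q s = j then G s else 0) \<le> (\<Sum>s<t. G s)" .
    moreover have "(\<Sum>j<i. pmf p j) \<le> (\<Sum>j<i. pmf q j)"
      using q by (auto simp: majorizing_def majorized_by_def)
    ultimately have "(\<Sum>j<i. pmf p j) - (\<Sum>s<t. G s) \<le> (\<Sum>j<i. r t q j)"
      by (simp add: residual_eq sum_subtractf)
    also have "\<dots> \<le> real (card {..<i}) * r t q (k q t)"
      using assms residual_le[OF True q] by (intro sum_bounded_above) auto
    finally show ?thesis using assms by (simp add: field_simps)
  qed
  then show ?thesis
    unfolding greedy_def[of _ _ _ t] step_weight_def using True self_in_majorizing[OF p]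
    by (auto intro!: cINF_greatest)
next
  case False
  then have "(\<Sum>s<t. G s) = 1" using sum_greedy_le_1[of t] by (simp add: mass_left_iff)
  then show ?thesis
    using False sum_pmf_le_1[of p "{..<i}"] by (simp add: greedy_zero divide_le_0_iff)
qed

section \<open>Convergence: the greedy weights form a coupling\<close>

lemma greedy_sums_1: "G sums 1"
proof -
  note n = sorted_distribution_pos[OF p]
  \<comment> \<open>By \<open>greedy_ge\<close> at \<open>i = n\<close>, each step removes at least
    the fraction \<open>1 / n\<close> of the remaining mass.\<close>
  have "1 - (\<Sum>s<t. G s) \<le> (1 - 1 / real n) ^ t" for t
  proof (induction t)
    case (Suc t)
    have "(1 - (\<Sum>s<t. G s)) / real n \<le> G t"
      using greedy_ge[of n t] n sorted_distribution_sum[OF p] by simp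
    then have "1 - (\<Sum>s<Suc t. G s) \<le> (1 - 1 / real n) * (1 - (\<Sum>s<t. G s))"
      by (simp add: algebra_simps diff_divide_distrib)
    also have "\<dots> \<le> (1 - 1 / real n) * (1 - 1 / real n) ^ t"
      using Suc n by (intro mult_left_mono) auto
    finally show ?case by simp
  qed simp
  then have lower: "1 - (1 - 1 / real n) ^ t \<le> (\<Sum>s<t. G s)" for t
    by (simp add: algebra_simps)
  have "(\<lambda>t. (1 - 1 / real n) ^ t) \<longlonglongrightarrow> 0"
    using n by (intro LIMSEQ_power_zero) auto
  then have "(\<lambda>t. 1 - (1 - 1 / real n) ^ t) \<longlonglongrightarrow> 1"
    by (auto intro: tendsto_eq_intros)
  then show ?thesis
    unfolding sums_def
    by (rule tendsto_sandwich[rotated 2, OF _ tendsto_const])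
      (auto simp: lower sum_greedy_le_1)
qed

lemma residual_tendsto_0:
  assumes "q \<in> S"
  shows "(\<lambda>t. r t q l) \<longlonglongrightarrow> 0"
proof -
  have "(\<lambda>t. 1 - (\<Sum>s<t. G s)) \<longlonglongrightarrow> 1 - 1"
    using greedy_sums_1 unfolding sums_def by (intro tendsto_intros)
  then have lim: "(\<lambda>t. 1 - (\<Sum>s<t. G s)) \<longlonglongrightarrow> 0" by simp
  have "r t q l \<le> 1 - (\<Sum>s<t. G s)" for t
  proof (cases "l < n")
    case True
    then show ?thesis
      unfolding residual_mass[OF assms, symmetric]
      by (intro member_le_sum) (auto simp: residual_nonneg assms)
  next
    case False
    then have "pmf q l = 0"
      using assms by (auto simp: majorizing_def sorted_distribution_def set_pmf_eq)
    moreover have "0 \<le> (\<Sum>s<t. if k q s = l then G s else 0)"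
      by (intro sum_nonneg) (auto simp: greedy_nonneg)
    ultimately show ?thesis
      using sum_greedy_le_1[of t] by (simp add: residual_eq)
  qed
  then show ?thesis
    using residual_nonneg[OF assms] by (intro tendsto_sandwich[OF _ _ tendsto_const lim]) auto
qed

lemma greedy_couples:
  assumes W: "pmf W = G"
  shows "couples n W S"
  unfolding couples_def
proof
  fix q assume q: "q \<in> S"
  \<comment> \<open>Step \<open>t\<close> is mapped to the index chosen for \<open>q\<close>. The
    value 0 only replaces out-of-range choices, which carry no weight.\<close>
  define f where "f t = (if k q t < n then k q t else 0)" for t
  have "pmf (map_pmf f W) l = pmf q l" for l
  proof -
    have "(\<lambda>t. if f t = l then G t else 0) sums pmf (map_pmf f W) l"
      using measure_pmf_nat_sums[of "f -` {l}" W] by (simp add: pmf_map W cong: if_cong)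
    moreover have "(if f t = l then G t else 0) = (if k q t = l then G t else 0)" for t
      using k_less[OF _ q, of t] greedy_zero[of t] by (auto simp: f_def)
    ultimately have "(\<lambda>t. if k q t = l then G t else 0) sums pmf (map_pmf f W) l"
      by simp
    moreover have "(\<lambda>t. if k q t = l then G t else 0) sums (pmf q l - 0)"
    proof -
      have "(\<lambda>t. pmf q l - r t q l) \<longlonglongrightarrow> pmf q l - 0"
        by (intro tendsto_intros residual_tendsto_0 q)
      then show ?thesis by (simp add: sums_def residual_eq)
    qed
    ultimately show ?thesis using sums_unique2 by fastforce
  qed
  then have "map_pmf f W = q" by (intro pmf_eqI)
  moreover have "\<forall>t. f t < n" using sorted_distribution_pos[OF p] by (simp add: f_def)
  ultimately show "\<exists>f. (\<forall>t. f t < n) \<and> map_pmf f W = q" by blast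
qed

section \<open>Comparison with an arbitrary coupling\<close>

lemma greedy_majorizes_coupling:
  assumes C: "couples n C S" and "finite A"
  shows "(\<Sum>a\<in>A. pmf C a) \<le> (\<Sum>t<card A. G t)"
  using \<open>finite A\<close>
proof (induction "card A" arbitrary: A)
  case (Suc N)
  then have ne: "A \<noteq> {}" by auto
  \<comment> \<open>Removing a lightest state leaves a set \<open>B\<close> as required by
    \<open>coupling_weight_le\<close>.\<close>
  obtain a where a: "a \<in> A" "\<And>b. b \<in> A \<Longrightarrow> pmf C a \<le> pmf C b"
    using ex_min_if_finite[of "pmf C ` A"] Suc.prems ne by fastforce
  define B where "B = A - {a}"
  have B: "finite B" "a \<notin> B" "A = insert a B" "card B = N"
    using Suc a by (auto simp: B_def)
  define x where "x = (\<Sum>b\<in>B. pmf C b)"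
  define y where "y = (\<Sum>t<N. G t)"
  obtain i where i: "1 \<le> i" "i \<le> n" "pmf C a \<le> ((\<Sum>j<i. pmf p j) - x) / real i"
    unfolding x_def using coupling_weight_le[OF p C B(1,2)] a(2) B(3) by blast
  have "x \<le> y"
    using Suc.hyps(1)[of B] B by (simp add: x_def y_def)
  \<comment> \<open>For fixed \<open>i \<ge> 1\<close> the bound \<open>x + (P i - x) / i\<close>
    has slope \<open>1 - 1 / i \<ge> 0\<close> in \<open>x\<close>, so \<open>x\<close> may be
    replaced by the larger \<open>y\<close>.\<close>
  then have "0 \<le> (y - x) * (1 - 1 / real i)"
    using i(1) by (intro mult_nonneg_nonneg) auto
  then have "x + ((\<Sum>j<i. pmf p j) - x) / real i \<le> y + ((\<Sum>j<i. pmf p j) - y) / real i"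
    by (simp add: algebra_simps diff_divide_distrib)
  moreover have "((\<Sum>j<i. pmf p j) - y) / real i \<le> G N"
    unfolding y_def using i by (intro greedy_ge)
  ultimately have "x + pmf C a \<le> y + G N" using i(3) by linarith
  then show ?case
    using B Suc.hyps(2) by (simp add: x_def y_def flip: Suc.hyps(2))
qed simp

lemma shannon_entropy_greedy_le:
  assumes "couples n C S"
  shows "shannon_entropy G \<le> shannon_entropy (pmf C)"
  by (intro shannon_entropy_le_of_majorized greedy_nonneg sum_greedy_le_1
      greedy_majorizes_coupling[OF assms])

end

theorem theorem2:
  fixes n :: nat and p :: "nat pmf" and S :: "nat pmf set"
    and k :: "nat pmf \<Rightarrow> nat \<Rightarrow> nat"
  assumes "sorted_distribution n p"
    and "S = majorizing n p"
    and "greedy_choice n S k"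
  shows "(\<exists>OPT. min_entropy_coupling n S OPT) \<and>
    (\<forall>OPT. min_entropy_coupling n S OPT \<longrightarrow>
       shannon_entropy (greedy n S k) = shannon_entropy (pmf OPT))"
proof -
  interpret greedy_run n p k
    using assms by unfold_locales auto
  \<comment> \<open>The greedy weights are themselves a coupling, so the lower bound also shows that
    a minimum exists.\<close>
  obtain W where W: "pmf W = greedy n (majorizing n p) k"
    using pmf_of_sums greedy_nonneg greedy_sums_1 by metis
  note couples_W = greedy_couples[OF W]
  have "min_entropy_coupling n (majorizing n p) W"
    using couples_W shannon_entropy_greedy_le by (simp add: min_entropy_coupling_def W)
  moreover have "shannon_entropy (greedy n (majorizing n p) k) = shannon_entropy (pmf OPT)"
    if "min_entropy_coupling n (majorizing n p) OPT" for OPT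
    using that couples_W shannon_entropy_greedy_le[of OPT]
    by (auto simp: min_entropy_coupling_def W[symmetric] intro: antisym)
  ultimately show ?thesis unfolding assms(2) by blast
qed

end
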